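(* Let $n\geq 2$ be an integer, let $a_1,\ldots,a_{\ell}$ be positive integers ($\ell\geq 1$), and let $A=a_1+\cdots+a_{\ell}$. If $A>2n$, then the 2-color Rado number of $$x_1+x_2+\cdots+x_n=a_1y_1+\cdots+a_{\ell}y_{\ell}$$ is at least $\left\lceil\frac{A}{n}\left\lceil\frac{A}{n}\right\rceil\right\rceil$.
   Context: For a positive integer $r$ write $[r]=\{1,\ldots,r\}$. The 2-color Rado number of an equation is the smallest positive integer $r$ such that for every coloring of the elements of $[r]$ with two colors there exists a solution of the equation using elements of $[r]$ that are all colored the same (a monochromatic solution). The values of distinct variables in a solution are not required to be distinct. (By a theorem of Rado, this number exists for every equation $a_1x_1+\cdots+a_nx_n=b_1y_1+\cdots+b_ky_k$ with all $a_i,b_j$ positive integers, $n,k\geq 1$ and $n+k\geq 3$.) *)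

theory Defs
  imports Complex_Main "HOL-Library.Extended_Nat"
begin

text \<open>
  The equation \<open>a\<^sub>1 x\<^sub>1 + \<dots> + a\<^sub>n x\<^sub>n = b\<^sub>1 y\<^sub>1 + \<dots> + b\<^sub>k y\<^sub>k\<close> is given by the coefficient
  families \<open>a\<close>, \<open>b\<close> and the numbers of variables \<open>n\<close>, \<open>k\<close>; only the indices \<open>1..n\<close> and
  \<open>1..k\<close> are relevant.
\<close>

definition is_solution ::
  "nat \<Rightarrow> (nat \<Rightarrow> nat) \<Rightarrow> nat \<Rightarrow> (nat \<Rightarrow> nat) \<Rightarrow> (nat \<Rightarrow> nat) \<Rightarrow> (nat \<Rightarrow> nat) \<Rightarrow> bool" where
  "is_solution n a k b x y \<longleftrightarrow> (\<Sum>i = 1..n. a i * x i) = (\<Sum>j = 1..k. b j * y j)"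

definition has_mono_solution ::
  "nat \<Rightarrow> (nat \<Rightarrow> nat) \<Rightarrow> nat \<Rightarrow> (nat \<Rightarrow> nat) \<Rightarrow> nat \<Rightarrow> (nat \<Rightarrow> bool) \<Rightarrow> bool" where
  "has_mono_solution n a k b r col \<longleftrightarrow>
     (\<exists>x y c. (\<forall>i\<in>{1..n}. x i \<in> {1..r} \<and> col (x i) = c) \<and>
              (\<forall>j\<in>{1..k}. y j \<in> {1..r} \<and> col (y j) = c) \<and>
              is_solution n a k b x y)"

text \<open>
  A 2-coloring of \<open>{1..r}\<close> is represented by a total function \<open>nat \<Rightarrow> bool\<close>, whose values
  outside \<open>{1..r}\<close> play no role. The Rado number is the least positive \<open>r\<close> such that every
  2-coloring of \<open>{1..r}\<close> admits a monochromatic solution. It is taken in the extended naturals,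
  with value \<open>\<infinity>\<close> if there is no such \<open>r\<close>; by Rado's theorem this does not happen when all
  coefficients are positive, \<open>n, k \<ge> 1\<close> and \<open>n + k \<ge> 3\<close>.
\<close>

definition rado_number2 ::
  "nat \<Rightarrow> (nat \<Rightarrow> nat) \<Rightarrow> nat \<Rightarrow> (nat \<Rightarrow> nat) \<Rightarrow> enat" where
  "rado_number2 n a k b =
     (INF r\<in>{r. 0 < r \<and> (\<forall>col. has_mono_solution n a k b r col)}. enat r)"

end

theory Submission
  imports Defs
begin

text \<open>
  The lower bound comes from a single coloring, which separates the numbers below
  \<open>m = \<lceil>A / n\<rceil>\<close> from those that are at least \<open>m\<close>. In either color class the right-hand side
  exceeds the left-hand side. With values below \<open>m\<close>, the left-hand side is at most
  \<open>n (m - 1) < A\<close>, and the right-hand side is at least \<open>A\<close>. With values from \<open>m\<close> to \<open>r\<close>, the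
  left-hand side is at most \<open>n r\<close> and the right-hand side at least \<open>A m\<close>, so no solution exists
  as long as \<open>r < A m / n\<close>.
\<close>

lemma not_is_solution_if_range_narrow:
  assumes "\<forall>i\<in>{1..n}. x i \<le> u" and "\<forall>j\<in>{1..l}. v \<le> y j"
    and "n * u < (\<Sum>j = 1..l. a j) * v"
  shows "\<not> is_solution n (\<lambda>_. 1) l a x y"
proof -
  have "(\<Sum>i = 1..n. x i) \<le> (\<Sum>i = 1..n. u)"
    using assms(1) by (intro sum_mono) auto
  also have "\<dots> < (\<Sum>j = 1..l. a j * v)"
    using assms(3) by (simp add: sum_distrib_right)
  also have "\<dots> \<le> (\<Sum>j = 1..l. a j * y j)"
    using assms(2) by (intro sum_mono mult_le_mono2) auto
  finally show ?thesis
    by (simp add: is_solution_def)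
qed

text \<open>
  The low color class has all values in \<open>[1, m - 1]\<close> and the high class all values in \<open>[m, r]\<close>.
  The two hypotheses say that each of these ranges is too narrow for the equation, in the sense
  of the preceding lemma.
\<close>

lemma threshold_coloring_no_mono_solution:
  assumes low: "n * (m - 1) < (\<Sum>j = 1..l. a j)"
    and high: "n * r < (\<Sum>j = 1..l. a j) * m"
  shows "\<not> has_mono_solution n (\<lambda>_. 1) l a r (\<lambda>v. v < m)"
proof
  assume "has_mono_solution n (\<lambda>_. 1) l a r (\<lambda>v. v < m)"
  then obtain x y c where
    x: "\<forall>i\<in>{1..n}. x i \<in> {1..r} \<and> (x i < m) = c" and
    y: "\<forall>j\<in>{1..l}. y j \<in> {1..r} \<and> (y j < m) = c" and
    sol: "is_solution n (\<lambda>_. 1) l a x y"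
    unfolding has_mono_solution_def by blast
  show False
  proof (cases c)
    case True
    have "\<forall>i\<in>{1..n}. x i \<le> m - 1" and "\<forall>j\<in>{1..l}. 1 \<le> y j"
      using x y True by fastforce+
    then show False
      using not_is_solution_if_range_narrow[of n x "m - 1" l 1 y a] low sol by simp
  next
    case False
    have "\<forall>i\<in>{1..n}. x i \<le> r" and "\<forall>j\<in>{1..l}. m \<le> y j"
      using x y False by fastforce+
    then show False
      using not_is_solution_if_range_narrow[of n x r l m y a] high sol by simp
  qed
qed

theorem theorem4:
  fixes n l A :: nat and a :: "nat \<Rightarrow> nat"
  assumes "n \<ge> 2"
    and "l \<ge> 1"
    and "\<forall>j\<in>{1..l}. a j > 0"
    and "A = (\<Sum>j = 1..l. a j)"
    and "A > 2 * n"
  shows "rado_number2 n (\<lambda>_. 1) l a \<ge>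
           enat (nat \<lceil>real A / real n * real_of_int \<lceil>real A / real n\<rceil>\<rceil>)"
proof -
  define m where "m = nat \<lceil>real A / real n\<rceil>"
  have n: "real n > 0" and A: "real A > 0"
    using assms(1,5) by simp_all
  have "\<lceil>real A / real n\<rceil> > 0"
    using n A by (simp add: zero_less_ceiling)
  then have ceil: "\<lceil>real A / real n\<rceil> = int m" and m: "m > 0"
    by (simp_all add: m_def)
  have "real (m - 1) < real A / real n"
    using ceil m by (simp add: of_nat_diff) linarith
  then have "real (n * (m - 1)) < real A"
    using n by (simp add: field_simps)
  then have low: "n * (m - 1) < (\<Sum>j = 1..l. a j)"
    using assms(4) by linarith
  have "nat \<lceil>real A / real n * real m\<rceil> \<le> r"
    if mono: "\<forall>col. has_mono_solution n (\<lambda>_. 1) l a r col" for r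
  proof (rule ccontr)
    assume "\<not> nat \<lceil>real A / real n * real m\<rceil> \<le> r"
    then have "real r < real A / real n * real m"
      by linarith
    then have "real (n * r) < real (A * m)"
      using n by (simp add: field_simps)
    then have "n * r < (\<Sum>j = 1..l. a j) * m"
      using assms(4) by (simp only: of_nat_less_iff)
    with low mono show False
      using threshold_coloring_no_mono_solution by blast
  qed
  then show ?thesis
    unfolding rado_number2_def ceil by (auto intro!: INF_greatest)
qed

end
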